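(* Let $d\geq 2$ and let $\Lambda$ be a full-rank lattice in $\mathbb{R}^d$. Let $\ell=\{\vec z=(z_1,\ldots,z_d)\in\mathbb{R}^d : z_i=0,\ i=2,\ldots,d\}$ be the first coordinate axis. Suppose $\ell\cap\Lambda=\{\vec 0\}$. Then $\hat\omega(\Lambda)=0$.
   Context: For $\vec z=(z_1,\ldots,z_d)\in\mathbb{R}^d$ set $|\vec z|=\max_{1\leq i\leq d}|z_i|$ and $\Pi(\vec z)=\prod_{i=1}^d|z_i|^{1/d}$. For $\pmb\lambda=(\lambda_1,\ldots,\lambda_d)\in\mathbb{R}_+^d$ (positive reals) let $\mathcal{P}(\pmb\lambda)=\{\vec z\in\mathbb{R}^d : |z_i|\leq\lambda_i,\ i=1,\ldots,d\}$. The uniform Diophantine exponent $\hat\omega(\Lambda)$ of a full-rank lattice $\Lambda\subset\mathbb{R}^d$ is the supremum of real numbers $\gamma$ such that for every sufficiently large $t$ and every $\pmb\lambda\in\mathbb{R}_+^d$ with $|\pmb\lambda|=t$ and $\Pi(\pmb\lambda)=t^{-\gamma}$, the parallelepiped $\mathcal{P}(\pmb\lambda)$ contains a nonzero point of $\Lambda$. *)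

theory Defs
  imports "HOL-Analysis.Analysis"
begin

definition full_rank_lattice :: "(real ^ 'n) set \<Rightarrow> bool" where
  "full_rank_lattice L \<longleftrightarrow>
     (\<exists>B. independent B \<and> span B = UNIV \<and>
          L = {\<Sum>b\<in>B. of_int (c b) *\<^sub>R b | c :: real ^ 'n \<Rightarrow> int. True})"

definition geom_mean :: "real ^ 'n \<Rightarrow> real" where
  "geom_mean z = (\<Prod>i\<in>UNIV. \<bar>z $ i\<bar> powr (1 / real CARD('n)))"

definition parallelepiped :: "real ^ 'n \<Rightarrow> (real ^ 'n) set" where
  "parallelepiped lam = {z. \<forall>i. \<bar>z $ i\<bar> \<le> lam $ i}"

text \<open>The maximum norm is the library's \<^const>\<open>infnorm\<close>.\<close>

lemma infnorm_eq_Max: "infnorm (z :: real ^ 'n) = Max (range (\<lambda>i. \<bar>z $ i\<bar>))"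
proof -
  have "{\<bar>z $ i\<bar> |i. i \<in> UNIV} = range (\<lambda>i. \<bar>z $ i\<bar>)"
    by auto
  then show ?thesis
    by (simp add: infnorm_cart cSup_eq_Max)
qed

text \<open>The supremum is taken in the extended reals, so that it is the true supremum
  even if the set of admissible \<open>\<gamma>\<close> is empty or unbounded.\<close>

definition uniform_exponent :: "(real ^ 'n) set \<Rightarrow> ereal" where
  "uniform_exponent L =
     Sup (ereal ` {\<gamma>. \<forall>\<^sub>F t in at_top. \<forall>lam :: real ^ 'n.
            (\<forall>i. 0 < lam $ i) \<and> infnorm lam = t \<and> geom_mean lam = t powr (- \<gamma>) \<longrightarrow>
            (\<exists>z \<in> L. z \<noteq> 0 \<and> z \<in> parallelepiped lam)})"

text \<open>A finite linearly ordered index type stands for \<open>{1,\<dots>,d}\<close>; its least element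
  is the index of the first coordinate.\<close>

definition first_axis :: "(real ^ 'n::{finite,linorder}) set" where
  "first_axis = {z. \<forall>i. i \<noteq> Min UNIV \<longrightarrow> z $ i = 0}"

end

theory Submission
  imports Defs
begin

text \<open>
  Negative exponents are admissible by Minkowski's theorem for boxes. For a positive exponent, call
  a box empty if it contains no nonzero lattice point. As the first axis contains no nonzero lattice
  point, there is an empty box whose first side is as long as we please. If the lattice
  points in a bounded dilate of an empty box lie in a hyperplane, then one coordinate is controlled on that
  hyperplane by the others. So, after shrinking the other sides by the factor \<open>d\<close>, that side
  can be doubled until the box meets a lattice point outside the hyperplane. After at most
  \<open>d\<close> such steps a bounded dilate of the empty box contains \<open>d\<close> independent lattice points, whose
  determinant bounds the volume of the box from below.
\<close>

section \<open>Empty boxes and matrix form of the lattice\<close>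

definition empty_box :: "(real ^ 'n) set \<Rightarrow> real ^ 'n \<Rightarrow> bool" where
  "empty_box L lam \<longleftrightarrow> (\<forall>i. 0 < lam $ i) \<and> L \<inter> parallelepiped lam \<subseteq> {0}"

text \<open>The columns of \<open>A\<close> are the basis vectors, enumerated by the index type.
  Lattice points then have integer coordinate vectors, which can be counted and put into
  determinants.\<close>

lemma full_rank_lattice_matrix:
  fixes L :: "(real ^ 'n) set"
  assumes "full_rank_lattice L"
  obtains A :: "real ^ 'n ^ 'n" where "invertible A" "L = (\<lambda>x. A *v x) ` {x. \<forall>i. x $ i \<in> \<int>}"
proof -
  obtain B where B: "independent B" "span B = UNIV"
    and L: "L = {\<Sum>b\<in>B. of_int (c b) *\<^sub>R b | c :: real ^ 'n \<Rightarrow> int. True}"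
    using assms unfolding full_rank_lattice_def by blast
  have fin: "finite B" using B(1) by (rule independent_imp_finite)
  have "card B = CARD('n)"
    using basis_card_eq_dim[of B UNIV] B by simp
  then obtain h :: "'n \<Rightarrow> real ^ 'n" where h: "bij_betw h UNIV B"
    using finite_same_card_bij[of "UNIV :: 'n set" B] fin by auto
  define A :: "real ^ 'n ^ 'n" where "A = transpose (\<chi> i. h i)"
  have Av: "A *v x = (\<Sum>i\<in>UNIV. (x $ i) *\<^sub>R h i)" for x
    by (simp add: A_def matrix_vector_mult_def vec_eq_iff transpose_def mult.commute)
  have rng: "rows (\<chi> i. h i) = B"
    using h by (auto simp: rows_def row_def bij_betw_def vec_lambda_eta)
  have "invertible (\<chi> i. h i)"
    using B(2) rng matrix_left_invertible_span_rows[of "\<chi> i. h i"]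
      matrix_left_right_inverse invertible_def by blast
  then have inv: "invertible A" unfolding A_def by (rule transpose_invertible)
  have "L = (\<lambda>x. A *v x) ` {x. \<forall>i. x $ i \<in> \<int>}"
  proof (intro set_eqI iffI)
    fix z assume "z \<in> L"
    then obtain c :: "real ^ 'n \<Rightarrow> int" where z: "z = (\<Sum>b\<in>B. of_int (c b) *\<^sub>R b)"
      using L by blast
    have "z = (\<Sum>i\<in>UNIV. of_int (c (h i)) *\<^sub>R h i)"
      unfolding z using sum.reindex_bij_betw[OF h, of "\<lambda>b. of_int (c b) *\<^sub>R b"] by simp
    then have "z = A *v (\<chi> i. of_int (c (h i)))" by (simp add: Av)
    then show "z \<in> (\<lambda>x. A *v x) ` {x. \<forall>i. x $ i \<in> \<int>}" by auto
  next
    fix z assume "z \<in> (\<lambda>x. A *v x) ` {x. \<forall>i. x $ i \<in> \<int>}"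
    then obtain x where x: "\<And>i. x $ i \<in> \<int>" "z = A *v x" by blast
    define c where "c b = \<lfloor>x $ inv_into UNIV h b\<rfloor>" for b
    have "of_int (c (h i)) = x $ i" for i
      using x(1) h by (simp add: c_def bij_betw_def)
    then have "z = (\<Sum>i\<in>UNIV. of_int (c (h i)) *\<^sub>R h i)"
      by (simp add: x Av)
    also have "\<dots> = (\<Sum>b\<in>B. of_int (c b) *\<^sub>R b)"
      using sum.reindex_bij_betw[OF h, of "\<lambda>b. of_int (c b) *\<^sub>R b"] by simp
    finally show "z \<in> L" using L by blast
  qed
  with inv that show ?thesis by blast
qed

section \<open>Minkowski's theorem for boxes\<close>

text \<open>Pigeonhole: among the images of the integer vectors in a cube of side \<open>N\<close>,
  two lie in the same translate of a cell with sides \<open>lam $ i\<close>, and their difference is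
  a nonzero lattice point in the box. The constant is far from sharp; what matters is that it does
  not depend on \<open>lam\<close>.\<close>

lemma minkowski_box:
  fixes A :: "real ^ 'n ^ 'n"
  assumes inv: "invertible A" and L: "L = (\<lambda>x. A *v x) ` {x. \<forall>i. x $ i \<in> \<int>}"
  obtains K where "K > 0"
    "\<And>lam. (\<forall>i. 0 < lam $ i) \<Longrightarrow> K < (\<Prod>i\<in>UNIV. lam $ i) \<Longrightarrow> \<not> empty_box L lam"
proof -
  \<comment> \<open>\<open>c\<close> dominates every absolute row sum of \<open>A\<close>, so
    \<open>A\<close> maps the cube of side \<open>N\<close> into the box with all half-sides
    \<open>c * N\<close>.\<close>
  define c where "c = 1 + (\<Sum>i\<in>UNIV. \<Sum>j\<in>UNIV. \<bar>A $ i $ j\<bar>)"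
  have c1: "c \<ge> 1" by (simp add: c_def sum_nonneg)
  have row: "(\<Sum>j\<in>UNIV. \<bar>A $ i $ j\<bar>) \<le> c" for i
    using member_le_sum[of i UNIV "\<lambda>i. \<Sum>j\<in>UNIV. \<bar>A $ i $ j\<bar>"] by (simp add: c_def sum_nonneg)
  have "\<not> empty_box L lam" if pos: "\<forall>i. 0 < lam $ i" and big: "(5 * c) ^ CARD('n) < (\<Prod>i\<in>UNIV. lam $ i)" for lam
  proof
    assume emp: "empty_box L lam"
    \<comment> \<open>\<open>N\<close> is taken so large that each ratio
      \<open>c * N / lam $ i\<close> is at least 1; this absorbs the rounding errors in the count of
      cells.\<close>
    obtain N0 :: nat where N0: "real N0 > (\<Sum>i\<in>UNIV. lam $ i)" using reals_Archimedean2 by blast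
    define N where "N = Suc N0"
    have Nl: "lam $ i \<le> c * N" for i
    proof -
      have "lam $ i \<le> (\<Sum>i\<in>UNIV. lam $ i)"
        using member_le_sum[of i UNIV "\<lambda>i. lam $ i"] pos by (simp add: less_imp_le)
      also have "\<dots> \<le> 1 * real N" using N0 by (simp add: N_def)
      also have "\<dots> \<le> c * N" using c1 by (intro mult_right_mono) auto
      finally show ?thesis .
    qed
    define q where "q i = \<lceil>c * N / lam $ i\<rceil>" for i
    define v :: "('n \<Rightarrow> nat) \<Rightarrow> real ^ 'n" where "v k = A *v (\<chi> i. real (k i))" for k
    \<comment> \<open>\<open>F k\<close> is the index of the cell that contains
      \<open>v k\<close>.\<close>
    define F where "F k = (\<lambda>i. \<lfloor>v k $ i / lam $ i\<rfloor>)" for k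
    define D where "D = (UNIV :: 'n set) \<rightarrow>\<^sub>E {0..<N}"
    define R where "R = Pi\<^sub>E (UNIV :: 'n set) (\<lambda>i. {- q i..q i})"
    have q0: "0 \<le> q i" for i
      using pos c1 by (simp add: q_def less_imp_le) (smt (verit) divide_nonneg_pos mult_nonneg_nonneg of_nat_0_le_iff)
    have cardD: "card D = N ^ CARD('n)" by (simp add: D_def card_PiE)
    have finR: "finite R" unfolding R_def by (intro finite_PiE) auto
    have cardR: "real (card R) = (\<Prod>i\<in>UNIV. 2 * q i + 1)"
      using q0 by (simp add: R_def card_PiE algebra_simps)
    have "real (card R) \<le> (\<Prod>i\<in>UNIV. 5 * c * N / lam $ i)"
      unfolding cardR of_int_prod
    proof (intro prod_mono conjI)
      fix i
      show "0 \<le> real_of_int (2 * q i + 1)" using q0[of i] by simp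
      have "1 \<le> c * N / lam $ i" using Nl[of i] pos by (simp add: pos_le_divide_eq)
      moreover have "q i \<le> c * N / lam $ i + 1" unfolding q_def by linarith
      \<comment> \<open>With y = \<open>c * N / lam $ i\<close> \<ge> 1, the count is at most 2(y +
        1) + 1 = 2y + 3 \<le> 5y. This is the origin of the factor 5.\<close>
      ultimately have "2 * q i + 1 \<le> 5 * (c * N / lam $ i)" by linarith
      then show "real_of_int (2 * q i + 1) \<le> 5 * c * N / lam $ i" by simp
    qed
    also have "\<dots> = (5 * c) ^ CARD('n) * real N ^ CARD('n) / (\<Prod>i\<in>UNIV. lam $ i)"
      by (simp add: prod_dividef power_mult_distrib)
    also have "\<dots> < real N ^ CARD('n)"
    proof -
      have "(\<Prod>i\<in>UNIV. lam $ i) > 0" using pos by (simp add: prod_pos)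
      moreover have "real N ^ CARD('n) > 0" by (simp add: N_def)
      ultimately show ?thesis using big by (simp add: pos_divide_less_eq mult.commute)
    qed
    finally have "card R < card D" unfolding cardD by (metis of_nat_less_iff of_nat_power)
    moreover have "F ` D \<subseteq> R"
    proof
      fix g assume "g \<in> F ` D"
      then obtain k where k: "k \<in> D" "g = F k" by blast
      have "g i \<in> {- q i..q i}" for i
      proof -
        have "\<bar>v k $ i\<bar> \<le> (\<Sum>j\<in>UNIV. \<bar>A $ i $ j * real (k j)\<bar>)"
          by (simp add: v_def matrix_vector_mult_def sum_abs)
        also have "\<dots> \<le> (\<Sum>j\<in>UNIV. \<bar>A $ i $ j\<bar> * N)"
        proof (rule sum_mono)
          fix j
          have "k j < N" using k(1) by (auto simp: D_def PiE_def Pi_def)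
          then show "\<bar>A $ i $ j * real (k j)\<bar> \<le> \<bar>A $ i $ j\<bar> * N"
            by (simp add: abs_mult mult_left_mono)
        qed
        also have "\<dots> \<le> c * N"
          using row[of i] by (simp add: sum_distrib_right[symmetric] mult_right_mono)
        finally have "\<bar>v k $ i / lam $ i\<bar> \<le> c * N / lam $ i"
          using pos by (simp add: abs_divide abs_of_pos divide_right_mono less_imp_le)
        then have "v k $ i / lam $ i \<le> q i" "- q i \<le> v k $ i / lam $ i"
          unfolding q_def by linarith+
        then show ?thesis unfolding k F_def by (simp add: le_floor_iff) linarith
      qed
      then show "g \<in> R" by (simp add: R_def PiE_def Pi_def)
    qed
    ultimately have "\<not> inj_on F D" using card_inj_on_le finR by (metis not_le)
    then obtain k k' where k: "k \<noteq> k'" "F k = F k'" by (auto simp: inj_on_def)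
    define x :: "real ^ 'n" where "x = (\<chi> i. real (k i)) - (\<chi> i. real (k' i))"
    have "x \<noteq> 0" using k(1) by (auto simp: x_def vec_eq_iff)
    then have nz: "A *v x \<noteq> 0"
      using inv by (metis invertible_def matrix_vector_mul_assoc matrix_vector_mul_lid matrix_vector_mult_0_right)
    have inL: "A *v x \<in> L" unfolding L by (auto simp: x_def)
    have "\<bar>(A *v x) $ i\<bar> \<le> lam $ i" for i
    proof -
      have e: "\<lfloor>v k $ i / lam $ i\<rfloor> = \<lfloor>v k' $ i / lam $ i\<rfloor>" using k(2) by (metis F_def)
      have "\<bar>v k $ i / lam $ i - v k' $ i / lam $ i\<bar> \<le> 1" using e by linarith
      moreover have "v k $ i / lam $ i - v k' $ i / lam $ i = (A *v x) $ i / lam $ i"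
        by (simp add: v_def x_def matrix_vector_mult_diff_distrib diff_divide_distrib)
      ultimately show ?thesis using pos by (simp add: abs_divide abs_of_pos pos_divide_le_eq)
    qed
    then have "A *v x \<in> L \<inter> parallelepiped lam" using inL by (simp add: parallelepiped_def)
    then show False using nz emp by (auto simp: empty_box_def)
  qed
  moreover have "(5 * c) ^ CARD('n) > 0" using c1 by simp
  ultimately show ?thesis using that by blast
qed

section \<open>Empty boxes with one long side\<close>

text \<open>An invertible \<open>A\<close> satisfies \<open>b * norm x \<le> norm (A *v x)\<close>
  for some \<open>b > 0\<close>, so the integer preimages of a bounded set are bounded.\<close>

lemma finite_lattice_bounded:
  fixes A :: "real ^ 'n ^ 'n"
  assumes inv: "invertible A" and bd: "bounded S"
  shows "finite ((\<lambda>x. A *v x) ` {x. \<forall>i. x $ i \<in> \<int>} \<inter> S)"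
proof -
  have "inj ((*v) A)" using inv by (simp add: inj_matrix_vector_mult)
  then obtain b where b: "b > 0" "\<And>x. b * norm x \<le> norm (A *v x)"
    using linear_inj_bounded_below_pos[of "(*v) A"] by (metis matrix_vector_mul_linear)
  obtain r where r: "\<And>z. z \<in> S \<Longrightarrow> norm z \<le> r" using bd by (auto simp: bounded_iff)
  define X where "X = (\<lambda>k. \<chi> i. real_of_int (k i)) ` ((UNIV :: 'n set) \<rightarrow>\<^sub>E {- \<lceil>r / b\<rceil>..\<lceil>r / b\<rceil>})"
  have "finite X" unfolding X_def by (intro finite_imageI finite_PiE) auto
  moreover have "(\<lambda>x. A *v x) ` {x. \<forall>i. x $ i \<in> \<int>} \<inter> S \<subseteq> (\<lambda>x. A *v x) ` X"
  proof
    fix z assume "z \<in> (\<lambda>x. A *v x) ` {x. \<forall>i. x $ i \<in> \<int>} \<inter> S"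
    then obtain x where x: "\<And>i. x $ i \<in> \<int>" "z = A *v x" "z \<in> S" by blast
    have "norm x \<le> r / b"
      using b(2)[of x] r[OF x(3)] b(1) x(2) by (simp add: pos_le_divide_eq mult.commute)
    then have le: "\<bar>x $ i\<bar> \<le> r / b" for i using component_le_norm_cart[of x i] by linarith
    have "\<lfloor>x $ i\<rfloor> \<in> {- \<lceil>r / b\<rceil>..\<lceil>r / b\<rceil>}" for i
      using le[of i] by (simp add: le_floor_iff) linarith
    then have "(\<lambda>i. \<lfloor>x $ i\<rfloor>) \<in> (UNIV :: 'n set) \<rightarrow>\<^sub>E {- \<lceil>r / b\<rceil>..\<lceil>r / b\<rceil>}"
      by (simp add: PiE_def Pi_def)
    moreover have "x = (\<chi> i. real_of_int \<lfloor>x $ i\<rfloor>)" using x(1) by (simp add: vec_eq_iff)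
    ultimately have "x \<in> X" unfolding X_def by (intro image_eqI[where x = "\<lambda>i. \<lfloor>x $ i\<rfloor>"])
    then show "z \<in> (\<lambda>x. A *v x) ` X" using x(2) by blast
  qed
  ultimately show ?thesis by (meson finite_imageI finite_subset)
qed

text \<open>Only finitely many lattice points lie in the box with side \<open>T\<close> along
  \<open>p\<close> and unit sides elsewhere. Once the other sides are below all their nonzero
  coordinates, any lattice point left must lie on the axis, hence is zero.\<close>

lemma empty_box_long_side:
  fixes A :: "real ^ 'n ^ 'n"
  assumes inv: "invertible A" and L: "L = (\<lambda>x. A *v x) ` {x. \<forall>i. x $ i \<in> \<int>}"
    and axis: "\<And>z. z \<in> L \<Longrightarrow> (\<And>i. i \<noteq> p \<Longrightarrow> z $ i = 0) \<Longrightarrow> z = 0"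
    and T: "T > 0"
  obtains lam where "empty_box L lam" "lam $ p = T"
proof -
  define box where "box e = (\<chi> i. if i = p then T else e)" for e :: real
  define Z where "Z = L \<inter> cbox (- box 1) (box 1) - {0}"
  have "finite Z" unfolding Z_def L using finite_lattice_bounded[OF inv bounded_cbox] by blast
  \<comment> \<open>The inserted 1 keeps \<open>E\<close> nonempty and forces \<open>e < 1\<close>,
    so that the thin box lies inside \<open>box 1\<close>.\<close>
  define E where "E = insert 1 ((\<lambda>(z, i). \<bar>z $ i\<bar>) ` (Z \<times> UNIV) - {0})"
  have finE: "finite E" using \<open>finite Z\<close> by (simp add: E_def)
  define e where "e = Min E / 2"
  have "Min E \<in> E" using finE by (intro Min_in) (auto simp: E_def)
  then have "Min E > 0" by (auto simp: E_def)
  then have e0: "e > 0" by (simp add: e_def)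
  have e_less: "e < w" if "w \<in> E" for w
    using Min_le[OF finE that] \<open>Min E > 0\<close> by (simp add: e_def)
  have e1: "e < 1" by (rule e_less) (simp add: E_def)
  have "empty_box L (box e)"
    unfolding empty_box_def
  proof (intro conjI allI subsetI)
    show "0 < box e $ i" for i using T e0 by (simp add: box_def)
    fix z assume z: "z \<in> L \<inter> parallelepiped (box e)"
    then have zb: "\<bar>z $ i\<bar> \<le> box e $ i" for i by (simp add: parallelepiped_def)
    show "z \<in> {0}"
    proof (rule ccontr)
      assume nz: "z \<notin> {0}"
      have "\<bar>z $ i\<bar> \<le> box 1 $ i" for i using zb[of i] e1 by (auto simp: box_def split: if_splits)
      then have "z \<in> cbox (- box 1) (box 1)"
        by (auto simp: mem_box_cart abs_le_iff) (metis minus_le_iff)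
      then have "z \<in> Z" using z nz by (simp add: Z_def)
      have "z $ i = 0" if "i \<noteq> p" for i
      proof (rule ccontr)
        assume "z $ i \<noteq> 0"
        then have "\<bar>z $ i\<bar> \<in> E" using \<open>z \<in> Z\<close> by (force simp: E_def)
        then show False using e_less zb[of i] that by (force simp: box_def)
      qed
      then show False using axis[of z] z nz by blast
    qed
  qed
  then show ?thesis using that[of "box e"] by (simp add: box_def)
qed

section \<open>Raising the dimension spanned by the lattice points of a dilate\<close>

text \<open>Take \<open>j\<close> that maximizes \<open>\<bar>a $ j\<bar> * lam $ j\<close>. Solving
  \<open>a \<bullet> z = 0\<close> for the term of index \<open>j\<close> leaves fewer than d other
  terms, each at most 1/d of that maximum.\<close>

lemma hyperplane_coordinate_bound:
  fixes a lam :: "real ^ 'n"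
  assumes a: "a \<noteq> 0" and pos: "\<And>i. 0 < lam $ i"
  obtains j where "\<And>z. a \<bullet> z = 0 \<Longrightarrow> (\<And>i. i \<noteq> j \<Longrightarrow> \<bar>z $ i\<bar> \<le> lam $ i / CARD('n)) \<Longrightarrow> \<bar>z $ j\<bar> \<le> lam $ j"
proof -
  define w where "w i = \<bar>a $ i\<bar> * lam $ i" for i
  obtain j where j: "\<And>i. w i \<le> w j"
    using obtains_MAX[of "UNIV :: 'n set" w] by (metis Max_ge UNIV_not_empty finite finite_imageI rangeI)
  obtain i0 where "a $ i0 \<noteq> 0" using a by (auto simp: vec_eq_iff)
  then have "w i0 > 0" using pos by (simp add: w_def)
  then have wj: "w j > 0" using j[of i0] by linarith
  have aj: "\<bar>a $ j\<bar> > 0" using wj by (auto simp: w_def)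
  have "\<bar>z $ j\<bar> \<le> lam $ j" if z: "a \<bullet> z = 0" "\<And>i. i \<noteq> j \<Longrightarrow> \<bar>z $ i\<bar> \<le> lam $ i / CARD('n)" for z
  proof -
    have "0 = (\<Sum>i\<in>UNIV. a $ i * z $ i)" using z(1) by (simp add: inner_vec_def)
    also have "\<dots> = a $ j * z $ j + (\<Sum>i\<in>UNIV - {j}. a $ i * z $ i)"
      by (simp add: sum.remove)
    finally have "\<bar>a $ j * z $ j\<bar> = \<bar>\<Sum>i\<in>UNIV - {j}. a $ i * z $ i\<bar>" by linarith
    also have "\<dots> \<le> (\<Sum>i\<in>UNIV - {j}. \<bar>a $ i * z $ i\<bar>)" by (rule sum_abs)
    also have "\<dots> \<le> (\<Sum>i\<in>UNIV - {j}. w j / CARD('n))"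
    proof (rule sum_mono)
      fix i assume "i \<in> UNIV - {j}"
      then have "\<bar>a $ i * z $ i\<bar> \<le> \<bar>a $ i\<bar> * (lam $ i / CARD('n))"
        unfolding abs_mult by (intro mult_left_mono z(2)) auto
      also have "\<dots> = w i / CARD('n)" by (simp add: w_def)
      also have "\<dots> \<le> w j / CARD('n)" using j by (simp add: divide_right_mono)
      finally show "\<bar>a $ i * z $ i\<bar> \<le> w j / CARD('n)" .
    qed
    also have "\<dots> \<le> (\<Sum>i\<in>(UNIV :: 'n set). w j / CARD('n))"
      by (rule sum_mono2) (use wj in \<open>auto simp: less_imp_le\<close>)
    also have "\<dots> = \<bar>a $ j\<bar> * lam $ j" by (simp add: w_def)
    finally show ?thesis using aj by (simp add: abs_mult)
  qed
  then show ?thesis using that by blast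
qed

text \<open>The side \<open>j\<close> supplied by the hyperplane can be stretched without meeting
  nonzero lattice points of the hyperplane. Minkowski's bound stops the stretching, so the first
  point met is a new direction. The factor 2 pays for the last doubling and the factor d for the
  initial shrinking.\<close>

lemma empty_box_dim_step:
  fixes L :: "(real ^ 'n) set" and C :: real
  assumes mink: "\<And>lam. (\<forall>i. 0 < lam $ i) \<Longrightarrow> K < (\<Prod>i\<in>UNIV. lam $ i) \<Longrightarrow> \<not> empty_box L lam"
    and emp: "empty_box L lam" and C: "C \<ge> 1"
    and dim: "dim (L \<inter> parallelepiped (C *\<^sub>R lam)) < CARD('n)"
  obtains lam' where "empty_box L lam'" "\<And>i. lam $ i / CARD('n) \<le> lam' $ i"
    "dim (L \<inter> parallelepiped (C *\<^sub>R lam)) < dim (L \<inter> parallelepiped ((2 * real CARD('n) * C) *\<^sub>R lam'))"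
proof -
  define S where "S = L \<inter> parallelepiped (C *\<^sub>R lam)"
  let ?d = "real CARD('n)"
  have d1: "?d \<ge> 1" by (simp add: Suc_le_eq)
  have pos: "\<And>i. 0 < lam $ i" using emp by (simp add: empty_box_def)
  obtain a where a: "a \<noteq> 0" "span S \<subseteq> {x. a \<bullet> x = 0}"
    using lowdim_subset_hyperplane[of S] dim by (auto simp: S_def)
  obtain j where j: "\<And>z. a \<bullet> z = 0 \<Longrightarrow> (\<And>i. i \<noteq> j \<Longrightarrow> \<bar>z $ i\<bar> \<le> lam $ i / ?d) \<Longrightarrow> \<bar>z $ j\<bar> \<le> lam $ j"
    using hyperplane_coordinate_bound[OF a(1) pos] by blast
  define box where "box m = (\<chi> i. if i = j then 2 ^ m * lam $ j else lam $ i / ?d)" for m :: nat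
  have box_pos: "\<forall>i. 0 < box m $ i" for m using pos by (simp add: box_def)
  have lam_d: "lam $ i / ?d \<le> lam $ i" for i
    using pos[of i] d1 by (simp add: pos_divide_le_eq)
  have "\<exists>m. \<not> empty_box L (box m)"
  proof -
    define P where "P = (\<Prod>i\<in>UNIV. box 0 $ i)"
    have P0: "P > 0" unfolding P_def using box_pos by (simp add: prod_pos)
    \<comment> \<open>Doubling one side doubles the volume, so \<open>box m\<close> has volume
      \<open>2 ^ m * P\<close> and cannot stay empty.\<close>
    obtain m where m: "K / P < 2 ^ m" using real_arch_pow[of 2 "K / P"] by auto
    have "(\<Prod>i\<in>UNIV. box m $ i) = box m $ j * (\<Prod>i\<in>UNIV - {j}. box m $ i)" for m
      by (simp add: prod.remove)
    moreover have "(\<Prod>i\<in>UNIV - {j}. box m $ i) = (\<Prod>i\<in>UNIV - {j}. box 0 $ i)"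
      by (intro prod.cong) (auto simp: box_def)
    ultimately have "(\<Prod>i\<in>UNIV. box m $ i) = 2 ^ m * P"
      unfolding P_def by (simp add: box_def)
    then have "K < (\<Prod>i\<in>UNIV. box m $ i)" using m P0 by (simp add: pos_divide_less_eq)
    then show ?thesis using mink box_pos by blast
  qed
  moreover have "empty_box L (box 0)"
  proof -
    have "box 0 $ i \<le> lam $ i" for i using lam_d by (simp add: box_def)
    then have "parallelepiped (box 0) \<subseteq> parallelepiped lam"
      unfolding parallelepiped_def by (auto intro: order_trans)
    then show ?thesis using emp box_pos by (auto simp: empty_box_def)
  qed
  \<comment> \<open>The new box must itself be empty, hence \<open>box m\<close>; the point outside
    the hyperplane comes from the next doubling.\<close>
  ultimately obtain m where m: "empty_box L (box m)" "\<not> empty_box L (box (Suc m))"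
    using nat_induct[of "\<lambda>m. empty_box L (box m)"] by blast
  obtain z where z: "z \<in> L" "z \<noteq> 0" "z \<in> parallelepiped (box (Suc m))"
    using m(2) box_pos by (auto simp: empty_box_def)
  have zb: "\<bar>z $ i\<bar> \<le> box (Suc m) $ i" for i using z(3) by (simp add: parallelepiped_def)
  \<comment> \<open>A point of the span satisfies the hyperplane equation, so its coordinate
    \<open>j\<close> is at most \<open>lam $ j\<close> however long the stretched side is. It would
    then lie in the original empty box.\<close>
  have "z \<notin> span S"
  proof
    assume "z \<in> span S"
    then have az: "a \<bullet> z = 0" using a(2) by blast
    have zi: "\<bar>z $ i\<bar> \<le> lam $ i / ?d" if "i \<noteq> j" for i using zb[of i] that by (simp add: box_def)
    have "\<bar>z $ i\<bar> \<le> lam $ i" for i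
      using j[OF az zi] zi[of i] lam_d[of i] by (cases "i = j") auto
    then have "z \<in> L \<inter> parallelepiped lam" using z(1) by (simp add: parallelepiped_def)
    then show False using emp z(2) by (auto simp: empty_box_def)
  qed
  then have "dim S < dim (insert z S)" by (simp add: dim_insert)
  \<comment> \<open>The dilate has to catch both the new point, which lies in
    \<open>box (Suc m)\<close>, and all old points, which lie in the dilate of \<open>lam\<close> by
    \<open>C\<close>.\<close>
  also have "\<dots> \<le> dim (L \<inter> parallelepiped ((2 * ?d * C) *\<^sub>R box m))"
  proof (rule dim_subset, rule insert_subsetI)
    have dC: "1 \<le> ?d * C" using d1 C mult_mono[of 1 ?d 1 C] by simp
    have "\<bar>z $ i\<bar> \<le> 2 * ?d * C * box m $ i" for i
    proof -
      have "box (Suc m) $ i \<le> 2 * box m $ i" using pos[of i] by (simp add: box_def divide_right_mono)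
      also have "\<dots> \<le> (?d * C) * (2 * box m $ i)"
        using mult_right_mono[OF dC, of "2 * box m $ i"] box_pos by (simp add: less_imp_le)
      finally show ?thesis using zb[of i] by (simp add: mult_ac)
    qed
    then show "z \<in> L \<inter> parallelepiped ((2 * ?d * C) *\<^sub>R box m)"
      using z(1) by (simp add: parallelepiped_def)
    have lb: "lam $ i \<le> 2 * ?d * box m $ i" for i
    proof -
      have "lam $ i \<le> 2 ^ m * lam $ i" using pos[of i] by simp
      moreover have "1 \<le> 2 * ?d" using d1 by linarith
      then have "2 ^ m * lam $ i \<le> (2 * ?d) * (2 ^ m * lam $ i)"
        using mult_right_mono[of 1 "2 * ?d" "2 ^ m * lam $ i"] pos[of i] by (simp add: less_imp_le)
      ultimately have "lam $ i \<le> (2 * ?d) * (2 ^ m * lam $ i)" by linarith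
      then show ?thesis using pos[of i] by (auto simp: box_def)
    qed
    have "C * lam $ i \<le> 2 * ?d * C * box m $ i" for i
      using mult_left_mono[OF lb[of i], of C] C by (simp add: mult_ac)
    then show "S \<subseteq> L \<inter> parallelepiped ((2 * ?d * C) *\<^sub>R box m)"
      unfolding S_def parallelepiped_def by (auto intro: order_trans)
  qed
  finally have "dim S < dim (L \<inter> parallelepiped ((2 * ?d * C) *\<^sub>R box m))" .
  moreover have "lam $ i / ?d \<le> box m $ i" for i
  proof -
    have "lam $ i \<le> 2 ^ m * lam $ i" using pos[of i] by simp
    then show ?thesis using lam_d[of i] by (auto simp: box_def)
  qed
  ultimately show ?thesis using that[of "box m"] m(1) by (simp add: S_def)
qed

text \<open>Each step multiplies the dilation by 2d and shrinks a side by at most d. The lower bound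
  on the sides is carried along so that the long side remains long.\<close>

lemma empty_box_dim_iterate:
  fixes L :: "(real ^ 'n) set"
  assumes mink: "\<And>lam. (\<forall>i. 0 < lam $ i) \<Longrightarrow> K < (\<Prod>i\<in>UNIV. lam $ i) \<Longrightarrow> \<not> empty_box L lam"
    and emp: "empty_box L lam" and k: "k \<le> CARD('n)"
  shows "\<exists>lam'. empty_box L lam' \<and> (\<forall>i. lam $ i / real CARD('n) ^ k \<le> lam' $ i) \<and>
    k \<le> dim (L \<inter> parallelepiped ((2 * real CARD('n)) ^ k *\<^sub>R lam'))"
  using k
proof (induction k)
  case 0
  then show ?case using emp by auto
next
  case (Suc k)
  let ?d = "real CARD('n)"
  have d1: "?d \<ge> 1" by (simp add: Suc_le_eq)
  obtain mu where mu: "empty_box L mu" "\<And>i. lam $ i / ?d ^ k \<le> mu $ i"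
    "k \<le> dim (L \<inter> parallelepiped ((2 * ?d) ^ k *\<^sub>R mu))"
    using Suc by (auto simp: Suc_leD)
  have pos: "\<And>i. 0 < mu $ i" using mu(1) by (simp add: empty_box_def)
  show ?case
  proof (cases "dim (L \<inter> parallelepiped ((2 * ?d) ^ k *\<^sub>R mu)) < CARD('n)")
    case True
    have "1 \<le> (2 * ?d) ^ k" using d1 by (intro one_le_power) linarith
    from empty_box_dim_step[OF mink mu(1) this True]
    obtain nu where nu: "empty_box L nu" "\<And>i. mu $ i / ?d \<le> nu $ i"
      "dim (L \<inter> parallelepiped ((2 * ?d) ^ k *\<^sub>R mu)) <
        dim (L \<inter> parallelepiped ((2 * ?d * (2 * ?d) ^ k) *\<^sub>R nu))" by blast
    have "lam $ i / ?d ^ Suc k \<le> nu $ i" for i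
      using divide_right_mono[OF mu(2)[of i], of ?d] nu(2)[of i] by (simp add: mult.commute)
    moreover have "Suc k \<le> dim (L \<inter> parallelepiped ((2 * ?d) ^ Suc k *\<^sub>R nu))"
      using mu(3) nu(3) by simp
    ultimately show ?thesis using nu(1) by blast
  next
    case False
    \<comment> \<open>The points already span the whole space, so \<open>mu\<close> is kept and only
      the constants are weakened.\<close>
    have "(2 * ?d) ^ k * mu $ i \<le> (2 * ?d) ^ Suc k * mu $ i" for i
      using pos[of i] d1 by (intro mult_right_mono power_increasing) linarith+
    then have "L \<inter> parallelepiped ((2 * ?d) ^ k *\<^sub>R mu) \<subseteq> L \<inter> parallelepiped ((2 * ?d) ^ Suc k *\<^sub>R mu)"
      unfolding parallelepiped_def by (auto intro: order_trans simp del: power_Suc)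
    then have "Suc k \<le> dim (L \<inter> parallelepiped ((2 * ?d) ^ Suc k *\<^sub>R mu))"
      using False Suc.prems dim_subset by (meson le_trans not_less)
    moreover have "lam $ i / ?d ^ Suc k \<le> mu $ i" for i
    proof -
      have "lam $ i / ?d ^ Suc k \<le> mu $ i / ?d"
        using divide_right_mono[OF mu(2)[of i], of ?d] by (simp add: mult.commute)
      also have "\<dots> \<le> mu $ i" using pos[of i] d1 by (simp add: pos_divide_le_eq)
      finally show ?thesis .
    qed
    ultimately show ?thesis using mu(1) by blast
  qed
qed

section \<open>Determinants and the volume of a box\<close>

lemma det_Ints:
  fixes M :: "real ^ 'n ^ 'n"
  assumes "\<And>i j. M $ i $ j \<in> \<int>"
  shows "det M \<in> \<int>"
  unfolding det_def using assms by (intro Ints_sum Ints_mult Ints_prod) auto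

text \<open>Each of the d! terms of the Leibniz expansion takes exactly one entry from every
  column.\<close>

lemma abs_det_le:
  fixes N :: "real ^ 'n ^ 'n"
  assumes "\<And>i j. \<bar>N $ i $ j\<bar> \<le> b $ j"
  shows "\<bar>det N\<bar> \<le> fact CARD('n) * (\<Prod>j\<in>UNIV. b $ j)"
proof -
  let ?P = "{p. p permutes (UNIV :: 'n set)}"
  have "\<bar>det N\<bar> \<le> (\<Sum>p\<in>?P. \<bar>of_int (sign p) * (\<Prod>i\<in>UNIV. N $ i $ p i)\<bar>)"
    unfolding det_def by (rule sum_abs)
  also have "\<dots> \<le> (\<Sum>p\<in>?P. \<Prod>j\<in>UNIV. b $ j)"
  proof (rule sum_mono)
    fix p assume p: "p \<in> ?P"
    have "\<bar>of_int (sign p) * (\<Prod>i\<in>UNIV. N $ i $ p i)\<bar> = (\<Prod>i\<in>UNIV. \<bar>N $ i $ p i\<bar>)"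
      by (simp add: abs_mult abs_prod sign_def)
    also have "\<dots> \<le> (\<Prod>i\<in>UNIV. b $ p i)" using assms by (intro prod_mono) auto
    also have "\<dots> = (\<Prod>j\<in>UNIV. b $ j)"
      using p prod.permute[of p UNIV "\<lambda>j. b $ j"] by (simp add: o_def)
    finally show "\<bar>of_int (sign p) * (\<Prod>i\<in>UNIV. N $ i $ p i)\<bar> \<le> (\<Prod>j\<in>UNIV. b $ j)" .
  qed
  also have "\<dots> = fact CARD('n) * (\<Prod>j\<in>UNIV. b $ j)"
    by (simp add: card_permutations[OF refl])
  finally show ?thesis .
qed

text \<open>Independent lattice points as rows form \<open>N = M ** transpose A\<close> with
  \<open>M\<close> integral. Since \<open>det M\<close> is a nonzero integer,
  \<open>\<bar>det A\<bar> \<le> \<bar>det N\<bar>\<close>, and the box bounds the entries of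
  \<open>N\<close>.\<close>

lemma det_le_spanning_box:
  fixes A :: "real ^ 'n ^ 'n"
  assumes inv: "invertible A" and L: "L = (\<lambda>x. A *v x) ` {x. \<forall>i. x $ i \<in> \<int>}"
    and dim: "CARD('n) \<le> dim (L \<inter> parallelepiped lam)"
  shows "\<bar>det A\<bar> \<le> fact CARD('n) * (\<Prod>i\<in>UNIV. lam $ i)"
proof -
  obtain W where W: "W \<subseteq> L \<inter> parallelepiped lam" "independent W"
    "card W = dim (L \<inter> parallelepiped lam)" "L \<inter> parallelepiped lam \<subseteq> span W"
    by (metis basis_exists)
  have fin: "finite W" using W(2) by (rule independent_imp_finite)
  have card: "card W = CARD('n)"
    using W(3) dim dim_subset_UNIV_cart[of "L \<inter> parallelepiped lam"] by linarith
  have sp: "span W = UNIV"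
    using card_eq_dim[of W UNIV] W(2) card fin by auto
  obtain h :: "'n \<Rightarrow> real ^ 'n" where h: "bij_betw h UNIV W"
    using finite_same_card_bij[of "UNIV :: 'n set" W] fin card by auto
  define N :: "real ^ 'n ^ 'n" where "N = (\<chi> i. h i)"
  have hW: "h i \<in> L" "h i \<in> parallelepiped lam" for i
    using h W(1) by (auto simp: bij_betw_def)
  have "\<exists>x. (\<forall>k. x $ k \<in> \<int>) \<and> h i = A *v x" for i using hW(1)[of i] by (auto simp: L)
  then obtain x where x: "\<And>i k. x i $ k \<in> \<int>" "\<And>i. h i = A *v x i" by metis
  define M :: "real ^ 'n ^ 'n" where "M = (\<chi> i. x i)"
  have NM: "N = M ** transpose A"
    by (simp add: N_def M_def x matrix_matrix_mult_def matrix_vector_mult_def transpose_def vec_eq_iff mult.commute)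
  have "rows N = W" using h by (auto simp: rows_def row_def N_def bij_betw_def vec_lambda_eta)
  then have "\<exists>B. B ** N = mat 1"
    using matrix_left_invertible_span_rows[of N] sp by (simp add: span_vec_eq)
  then have "det N \<noteq> 0" using matrix_left_right_inverse invertible_det_nz invertible_def by blast
  then have "det M \<noteq> 0" by (auto simp: NM det_mul)
  moreover have "det M \<in> \<int>" by (rule det_Ints) (simp add: M_def x)
  ultimately have "1 \<le> \<bar>det M\<bar>" by (rule Ints_nonzero_abs_ge1[rotated])
  then have "\<bar>det A\<bar> \<le> \<bar>det N\<bar>"
    using mult_right_mono[of 1 "\<bar>det M\<bar>" "\<bar>det A\<bar>"] by (simp add: NM det_mul abs_mult)
  also have "\<dots> \<le> fact CARD('n) * (\<Prod>i\<in>UNIV. lam $ i)"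
    using hW(2) by (intro abs_det_le) (simp add: N_def parallelepiped_def)
  finally show ?thesis .
qed

text \<open>The point is that \<open>c\<close> is independent of \<open>T\<close>: an empty box with
  a long side may start out arbitrarily thin, but d dimension steps make its dilate by
  \<open>C\<close> contain a spanning set of lattice points, and the determinant then bounds the
  volume.\<close>

lemma large_empty_boxes:
  fixes A :: "real ^ 'n ^ 'n"
  assumes inv: "invertible A" and L: "L = (\<lambda>x. A *v x) ` {x. \<forall>i. x $ i \<in> \<int>}"
    and axis: "\<And>z. z \<in> L \<Longrightarrow> (\<And>i. i \<noteq> p \<Longrightarrow> z $ i = 0) \<Longrightarrow> z = 0"
  obtains c where "c > 0"
    "\<And>T. \<exists>lam. empty_box L lam \<and> T \<le> lam $ p \<and> c \<le> (\<Prod>i\<in>UNIV. lam $ i)"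
proof -
  let ?d = "real CARD('n)" and ?n = "CARD('n)"
  define C where "C = (2 * ?d) ^ ?n"
  have C0: "C > 0" by (simp add: C_def)
  define c where "c = \<bar>det A\<bar> / (fact ?n * C ^ ?n)"
  have c0: "c > 0" using inv C0 by (simp add: c_def invertible_det_nz)
  obtain K where K: "\<And>lam. (\<forall>i. 0 < lam $ i) \<Longrightarrow> K < (\<Prod>i\<in>UNIV. lam $ i) \<Longrightarrow> \<not> empty_box L lam"
    using minkowski_box[OF inv L] by metis
  have "\<exists>lam. empty_box L lam \<and> T \<le> lam $ p \<and> c \<le> (\<Prod>i\<in>UNIV. lam $ i)" for T
  proof -
    \<comment> \<open>The iteration may shrink the side \<open>p\<close> by as much as d^d, so it
      starts longer by that factor; \<open>max 1\<close> makes it positive.\<close>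
    have "max 1 T * ?d ^ ?n > 0" by simp
    then obtain lam where lam: "empty_box L lam" "lam $ p = max 1 T * ?d ^ ?n"
      using empty_box_long_side[OF inv L axis] by blast
    obtain mu where mu: "empty_box L mu" "\<And>i. lam $ i / ?d ^ ?n \<le> mu $ i"
      "?n \<le> dim (L \<inter> parallelepiped (C *\<^sub>R mu))"
      using empty_box_dim_iterate[OF K lam(1) order_refl] unfolding C_def by blast
    have "T \<le> mu $ p" using mu(2)[of p] lam(2) by simp
    moreover have "\<bar>det A\<bar> \<le> fact ?n * (C ^ ?n * (\<Prod>i\<in>UNIV. mu $ i))"
      using det_le_spanning_box[OF inv L mu(3)] by (simp add: prod.distrib)
    then have "c \<le> (\<Prod>i\<in>UNIV. mu $ i)"
      using C0 by (simp add: c_def pos_divide_le_eq mult_ac)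
    ultimately show ?thesis using mu(1) by blast
  qed
  then show ?thesis using that c0 by blast
qed

section \<open>The uniform exponent\<close>

lemma geom_mean_eq:
  fixes lam :: "real ^ 'n"
  assumes "\<And>i. 0 < lam $ i"
  shows "geom_mean lam = (\<Prod>i\<in>UNIV. lam $ i) powr (1 / CARD('n))"
  using assms by (simp add: geom_mean_def prod_powr_distrib less_imp_le)

theorem theorem2:
  fixes L :: "(real ^ 'n::{finite,linorder}) set"
  assumes "CARD('n) \<ge> 2"
    and "full_rank_lattice L"
    and "first_axis \<inter> L = {0}"
  shows "uniform_exponent L = 0"
proof -
  let ?n = "CARD('n)"
  define G where "G = {\<gamma>. \<forall>\<^sub>F t in at_top. \<forall>lam :: (real, 'n) vec.
            (\<forall>i. 0 < lam $ i) \<and> infnorm lam = t \<and> geom_mean lam = t powr (- \<gamma>) \<longrightarrow>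
            (\<exists>z \<in> L. z \<noteq> 0 \<and> z \<in> parallelepiped lam)}"
  obtain A :: "((real, 'n) vec, 'n) vec" where inv: "invertible A" and L: "L = (\<lambda>x. A *v x) ` {x. \<forall>i. x $ i \<in> \<int>}"
    using full_rank_lattice_matrix[OF assms(2)] by blast
  have axis: "z = 0" if "z \<in> L" "\<And>i. i \<noteq> Min UNIV \<Longrightarrow> z $ i = 0" for z
    using assms(3) that by (auto simp: first_axis_def)
  have neg: "\<gamma> \<in> G" if "\<gamma> < 0" for \<gamma>
  proof -
    obtain K where K: "K > 0"
      "\<And>lam. (\<forall>i. 0 < lam $ i) \<Longrightarrow> K < (\<Prod>i\<in>UNIV. lam $ i) \<Longrightarrow> \<not> empty_box L lam"
      using minkowski_box[OF inv L] by metis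
    \<comment> \<open>\<open>M\<close> solves \<open>M powr (- \<gamma>) = K powr (1 / ?n)\<close>,
      so beyond \<open>M\<close> the prescribed volume exceeds Minkowski's constant.\<close>
    define M where "M = (K powr (1 / ?n)) powr (1 / - \<gamma>)"
    have "K powr (1 / ?n) < t powr (- \<gamma>)" if "M < t" for t
    proof -
      have "M powr (- \<gamma>) < t powr (- \<gamma>)"
        using that \<open>\<gamma> < 0\<close> by (intro powr_less_mono2) (auto simp: M_def)
      moreover have "M powr (- \<gamma>) = K powr (1 / ?n)"
        unfolding M_def using \<open>\<gamma> < 0\<close> by (simp only: powr_powr) simp
      ultimately show ?thesis by simp
    qed
    then have "\<forall>\<^sub>F t::real in at_top. K powr (1 / ?n) < t powr (- \<gamma>)"
      by (auto intro: eventually_mono[OF eventually_gt_at_top[of M]])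
    then show ?thesis unfolding G_def mem_Collect_eq
    proof (rule eventually_mono, intro allI impI)
      fix t :: real and lam :: "(real, 'n) vec"
      assume t: "K powr (1 / ?n) < t powr (- \<gamma>)"
        and lam: "(\<forall>i. 0 < lam $ i) \<and> infnorm lam = t \<and> geom_mean lam = t powr (- \<gamma>)"
      then have "K powr (1 / ?n) < (\<Prod>i\<in>UNIV. lam $ i) powr (1 / ?n)"
        using geom_mean_eq[of lam] by simp
      moreover have "(\<Prod>i\<in>UNIV. lam $ i) > 0" using lam by (simp add: prod_pos)
      ultimately have "K < (\<Prod>i\<in>UNIV. lam $ i)"
        using powr_mono2[of "1 / ?n" "\<Prod>i\<in>UNIV. lam $ i" K] by fastforce
      then have "\<not> empty_box L lam" using K(2) lam by blast
      then show "\<exists>z \<in> L. z \<noteq> 0 \<and> z \<in> parallelepiped lam"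
        using lam by (auto simp: empty_box_def)
    qed
  qed
  have nonpos: "\<gamma> \<le> 0" if "\<gamma> \<in> G" for \<gamma>
  proof (rule ccontr)
    assume "\<not> \<gamma> \<le> 0"
    then have g0: "\<gamma> > 0" by simp
    obtain c where c: "c > 0"
      "\<And>T. \<exists>lam. empty_box L lam \<and> T \<le> lam $ Min UNIV \<and> c \<le> (\<Prod>i\<in>UNIV. lam $ i)"
      using large_empty_boxes[OF inv L axis] by metis
    \<comment> \<open>A box with geometric mean \<open>t powr (- \<gamma>)\<close> has side product
      \<open>t powr (- (\<gamma> * ?n))\<close>, which eventually drops below
      \<open>c\<close>.\<close>
    have "((\<lambda>t::real. t powr (- (\<gamma> * ?n))) \<longlongrightarrow> 0) at_top"
      using g0 by (intro tendsto_neg_powr filterlim_ident) auto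
    then have "\<forall>\<^sub>F t::real in at_top. t powr (- (\<gamma> * ?n)) < c"
      using c(1) by (rule order_tendstoD)
    with that[unfolded G_def mem_Collect_eq] have "\<forall>\<^sub>F t::real in at_top. t powr (- (\<gamma> * ?n)) < c \<and>
      (\<forall>lam :: (real, 'n) vec. (\<forall>i. 0 < lam $ i) \<and> infnorm lam = t \<and> geom_mean lam = t powr (- \<gamma>) \<longrightarrow>
            (\<exists>z \<in> L. z \<noteq> 0 \<and> z \<in> parallelepiped lam))"
      by (auto elim: eventually_elim2)
    then obtain T where T: "\<And>t. t \<ge> T \<Longrightarrow> t powr (- (\<gamma> * ?n)) < c"
      "\<And>t lam :: (real, 'n) vec. t \<ge> T \<Longrightarrow> (\<forall>i. 0 < lam $ i) \<and> infnorm lam = t \<and> geom_mean lam = t powr (- \<gamma>) \<Longrightarrow>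
            (\<exists>z \<in> L. z \<noteq> 0 \<and> z \<in> parallelepiped lam)"
      unfolding eventually_at_top_linorder by blast
    obtain lam where lam: "empty_box L lam" "T \<le> lam $ Min UNIV" "c \<le> (\<Prod>i\<in>UNIV. lam $ i)"
      using c(2) by blast
    have pos: "\<And>i. 0 < lam $ i" using lam(1) by (simp add: empty_box_def)
    define t where "t = infnorm lam"
    have tMax: "t = Max (range (\<lambda>i. lam $ i))"
      using pos by (simp add: t_def infnorm_eq_Max abs_of_pos)
    have le_t: "lam $ i \<le> t" for i unfolding tMax by (intro Max_ge) auto
    have "t \<in> range (\<lambda>i. lam $ i)" unfolding tMax by (intro Max_in) auto
    then obtain m where m: "lam $ m = t" by auto
    have tT: "t \<ge> T" using le_t lam(2) order_trans by blast
    have t0: "t > 0" using pos m by metis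
    \<comment> \<open>The longest side \<open>m\<close> need not be the first one. As d \<ge> 2,
      there is another side, which can be shortened without changing the maximum norm.\<close>
    obtain j where j: "j \<noteq> m"
    proof -
      have "\<not> (UNIV :: 'n set) \<subseteq> {m}" using assms(1) card_mono[of "{m}" UNIV] by auto
      then show ?thesis using that by auto
    qed
    \<comment> \<open>Shortening the side \<open>j\<close> by \<open>r\<close> gives exactly the
      volume that the exponent prescribes at \<open>t\<close>. Since \<open>r \<le> 1\<close>, the
      new box lies in \<open>lam\<close> and is empty too.\<close>
    define r where "r = t powr (- (\<gamma> * ?n)) / (\<Prod>i\<in>UNIV. lam $ i)"
    have P0: "(\<Prod>i\<in>UNIV. lam $ i) > 0" using pos by (simp add: prod_pos)
    have r: "0 < r" "r \<le> 1"
      using P0 t0 T(1)[OF tT] lam(3) by (auto simp: r_def)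
    define mu :: "(real, 'n) vec" where "mu = (\<chi> i. if i = j then r * lam $ i else lam $ i)"
    have mu_pos: "\<And>i. 0 < mu $ i" using pos r by (simp add: mu_def)
    have mu_le: "mu $ i \<le> lam $ i" for i
      using r pos[of i] by (auto simp: mu_def intro!: mult_left_le_one_le)
    have "infnorm mu = Max (range (\<lambda>i. mu $ i))"
      using mu_pos by (simp add: infnorm_eq_Max abs_of_pos)
    also have "\<dots> = t"
    proof (rule Max_eqI)
      show "t \<in> range (\<lambda>i. mu $ i)" using m j by (metis (mono_tags, lifting) mu_def rangeI vec_lambda_beta)
      show "y \<le> t" if "y \<in> range (\<lambda>i. mu $ i)" for y using that mu_le le_t order_trans by blast
    qed auto
    finally have imu: "infnorm mu = t" .
    have "(\<Prod>i\<in>UNIV. mu $ i) = mu $ j * (\<Prod>i\<in>UNIV - {j}. mu $ i)" by (simp add: prod.remove)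
    also have "(\<Prod>i\<in>UNIV - {j}. mu $ i) = (\<Prod>i\<in>UNIV - {j}. lam $ i)"
      by (intro prod.cong) (auto simp: mu_def)
    also have "mu $ j * \<dots> = r * (\<Prod>i\<in>UNIV. lam $ i)" by (simp add: mu_def prod.remove[of UNIV j])
    also have "\<dots> = t powr (- (\<gamma> * ?n))" using less_imp_neq[OF P0] unfolding r_def by (metis nonzero_eq_divide_eq)
    finally have "geom_mean mu = t powr (- \<gamma>)"
      using geom_mean_eq[of mu] mu_pos by (simp add: powr_powr)
    then obtain z where z: "z \<in> L" "z \<noteq> 0" "z \<in> parallelepiped mu"
      using T(2)[OF tT, of mu] imu mu_pos by blast
    then have "z \<in> parallelepiped lam"
      using mu_le unfolding parallelepiped_def by (auto intro: order_trans)
    then show False using z lam(1) by (auto simp: empty_box_def)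
  qed
  have "Sup (ereal ` G) = 0"
  proof (rule antisym)
    show "Sup (ereal ` G) \<le> 0" using nonpos by (auto intro!: SUP_least)
    show "0 \<le> Sup (ereal ` G)"
    \<comment> \<open>Whether 0 itself is admissible is left open; the negative exponents already
      approach it.\<close>
    proof (rule dense_le)
      fix x :: ereal assume "x < 0"
      then obtain \<gamma> where "x < ereal \<gamma>" "ereal \<gamma> < 0" using ereal_dense2 by blast
      then show "x \<le> Sup (ereal ` G)" using neg by (intro Sup_upper2[of "ereal \<gamma>"]) auto
    qed
  qed
  then show ?thesis by (simp add: uniform_exponent_def G_def)
qed

end
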